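(* Let $m\ge 3$ be an integer and $0<a<1$. Then the map $$f(\lambda):=(a\lambda^{m-2},(1-a)\lambda^{m-1}),\quad \lambda\in\mathbb{D},$$ is an $m$-extremal, but not an $m$-geodesic, of the domain $\{z\in\mathbb{C}^2:|z_1|+|z_2|<1\}$.
   Context: $\mathbb{D}$ is the open unit disc in $\mathbb{C}$. For a domain $D\subset\mathbb{C}^n$, $\mathcal{O}(\overline{\mathbb{D}},D)$ denotes the set of mappings holomorphic in a neighborhood of $\overline{\mathbb{D}}$ with values in $D$. A holomorphic mapping $f:\mathbb{D}\to D$ is a weak $m$-extremal for pairwise distinct points $\lambda_1,\ldots,\lambda_m\in\mathbb{D}$ if there is no $h\in\mathcal{O}(\overline{\mathbb{D}},D)$ with $h(\lambda_j)=f(\lambda_j)$, $j=1,\ldots,m$. It is an $m$-extremal (of $D$) if it is a weak $m$-extremal for every choice of pairwise distinct $\lambda_1,\ldots,\lambda_m\in\mathbb{D}$. A finite Blaschke product of degree $k\in\{0,1,2,\ldots\}$ is a function $\zeta\prod_{j=1}^k m_{\alpha_j}$ with $|\zeta|=1$, $\alpha_j\in\mathbb{D}$, $m_\alpha(\lambda)=\frac{\lambda-\alpha}{1-\overline{\alpha}\lambda}$. A holomorphic mapping $f:\mathbb{D}\to D$ is an $m$-geodesic (of $D$) if there is a holomorphic $F:D\to\mathbb{D}$ such that $F\circ f$ is a non-constant Blaschke product of degree at most $m-1$. *)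

theory Defs
  imports "HOL-Complex_Analysis.Complex_Analysis"
begin

abbreviation unit_disc :: "complex set" where
  "unit_disc \<equiv> ball 0 1"

definition holomorphic_map_on :: "(complex \<Rightarrow> complex ^ 'n) \<Rightarrow> complex set \<Rightarrow> bool" where
  "holomorphic_map_on f U \<longleftrightarrow> (\<forall>i. (\<lambda>z. f z $ i) holomorphic_on U)"

text \<open>Holomorphy of a function of several complex variables: real Frechet differentiability
  with a complex-linear derivative at every point. It is meant for open \<open>D\<close>.\<close>

definition holomorphic_fun_on :: "(complex ^ 'n \<Rightarrow> complex) \<Rightarrow> (complex ^ 'n) set \<Rightarrow> bool" where
  "holomorphic_fun_on F D \<longleftrightarrow>
     (\<forall>z\<in>D. \<exists>L. (F has_derivative L) (at z within D) \<and> (\<forall>c v. L (c *s v) = c * L v))"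

definition holomorphic_near_closed_disc :: "(complex ^ 'n) set \<Rightarrow> (complex \<Rightarrow> complex ^ 'n) set" where
  "holomorphic_near_closed_disc D =
     {h. \<exists>U. open U \<and> cball 0 1 \<subseteq> U \<and> holomorphic_map_on h U \<and> h ` U \<subseteq> D}"

definition weak_m_extremal ::
  "nat \<Rightarrow> (nat \<Rightarrow> complex) \<Rightarrow> (complex ^ 'n) set \<Rightarrow> (complex \<Rightarrow> complex ^ 'n) \<Rightarrow> bool" where
  "weak_m_extremal m l D f \<longleftrightarrow>
     holomorphic_map_on f unit_disc \<and> f ` unit_disc \<subseteq> D \<and>
     \<not> (\<exists>h \<in> holomorphic_near_closed_disc D. \<forall>j\<in>{1..m}. h (l j) = f (l j))"

definition m_extremal ::
  "nat \<Rightarrow> (complex ^ 'n) set \<Rightarrow> (complex \<Rightarrow> complex ^ 'n) \<Rightarrow> bool" where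
  "m_extremal m D f \<longleftrightarrow>
     holomorphic_map_on f unit_disc \<and> f ` unit_disc \<subseteq> D \<and>
     (\<forall>l. l ` {1..m} \<subseteq> unit_disc \<and> inj_on l {1..m} \<longrightarrow> weak_m_extremal m l D f)"

definition disc_moebius :: "complex \<Rightarrow> complex \<Rightarrow> complex" where
  "disc_moebius \<alpha> z = (z - \<alpha>) / (1 - cnj \<alpha> * z)"

definition blaschke_product :: "nat \<Rightarrow> (complex \<Rightarrow> complex) \<Rightarrow> bool" where
  "blaschke_product k B \<longleftrightarrow>
     (\<exists>\<zeta> \<alpha>. norm \<zeta> = 1 \<and> (\<forall>j\<in>{1..k}. \<alpha> j \<in> unit_disc) \<and>
        (\<forall>z\<in>unit_disc. B z = \<zeta> * (\<Prod>j=1..k. disc_moebius (\<alpha> j) z)))"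

definition m_geodesic ::
  "nat \<Rightarrow> (complex ^ 'n) set \<Rightarrow> (complex \<Rightarrow> complex ^ 'n) \<Rightarrow> bool" where
  "m_geodesic m D f \<longleftrightarrow>
     holomorphic_map_on f unit_disc \<and> f ` unit_disc \<subseteq> D \<and>
     (\<exists>F. holomorphic_fun_on F D \<and> F ` D \<subseteq> unit_disc \<and>
        (\<exists>k. k \<le> m - 1 \<and> blaschke_product k (F \<circ> f)) \<and>
        \<not> (F \<circ> f) constant_on unit_disc)"

end

theory Submission
  imports Defs
begin

text \<open>Extremality: if \<open>h\<close> interpolates \<open>f\<close>, then \<open>\<phi>(z) = z h\<^sub>1(z) + h\<^sub>2(z)\<close> has modulus
  less than 1 on the unit circle and agrees with \<open>z\<^bsup>m-1\<^esup>\<close> at \<open>m\<close> points of the disc, which is one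
  point too many.

  Not geodesic: normalise by \<open>F(0) = 0\<close> and write \<open>F(f(z)) = z\<^bsup>m-2\<^esup> \<psi>(z)\<close>; this is possible by the
  Schwarz lemma on complex lines through the origin. If \<open>F \<circ> f\<close> were a Blaschke product of degree at
  most \<open>m - 1\<close>, then \<open>\<psi>\<close> would be a Moebius map or a unimodular constant, so equality would hold
  in the Schwarz-Pick estimate: \<open>|\<psi>'(0)| = 1 - |\<psi>(0)|\<^sup>2\<close>. On the other hand, comparing \<open>F(f(z))\<close> with
  \<open>F(a z\<^bsup>m-2\<^esup>, 0)\<close> by the Schwarz-Pick lemma in the second variable costs at most \<open>1 - a\<close>, and
  the Schwarz-Pick lemma in the first variable gives \<open>|\<psi>'(0)| \<le> 1 - a + a\<^sup>2 - |\<psi>(0)|\<^sup>2\<close>. As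
  \<open>a\<^sup>2 < a\<close>, the two are incompatible.\<close>

section \<open>Agreement of a map of the disc with a power of z\<close>

text \<open>Zeros are split off one at a time by removing the singularity of the difference
  quotient. As the points are distinct, the factors already extracted do not vanish at the next
  point, so the cofactor must.\<close>

lemma holomorphic_divide_zeros:
  assumes "open U" "f holomorphic_on U" "finite A" "A \<subseteq> U" "\<And>a. a \<in> A \<Longrightarrow> f a = 0"
  obtains g where "g holomorphic_on U" "\<And>z. z \<in> U \<Longrightarrow> f z = g z * (\<Prod>a\<in>A. z - a)"
proof -
  have "\<exists>g. g holomorphic_on U \<and> (\<forall>z\<in>U. f z = g z * (\<Prod>a\<in>A. z - a))"
    using assms(3-)
  proof (induction A rule: finite_induct)
    case empty
    show ?case using assms(2) by auto
  next
    case (insert b A)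
    then obtain g where g: "g holomorphic_on U" "\<forall>z\<in>U. f z = g z * (\<Prod>a\<in>A. z - a)"
      by auto
    have "g b * (\<Prod>a\<in>A. b - a) = 0"
      using g(2) insert.prems by (metis insertI1 insert_subset)
    then have "g b = 0"
      using insert.hyps by auto
    define k where "k = (\<lambda>z. if z = b then deriv g b else (g z - g b) / (z - b))"
    have "k holomorphic_on U"
      unfolding k_def using insert.prems assms(1) g(1) by (intro pole_lemma_open) auto
    moreover have "g z = k z * (z - b)" for z
      using \<open>g b = 0\<close> by (simp add: k_def)
    then have "\<forall>z\<in>U. f z = k z * (\<Prod>a\<in>insert b A. z - a)"
      using g(2) insert.hyps by (simp add: mult.assoc)
    ultimately show ?case by blast
  qed
  then show thesis using that by blast
qed

lemma one_minus_cnj_mult_nonzero: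
  fixes w z :: complex
  assumes "norm w < 1" "norm z \<le> 1"
  shows "1 - cnj w * z \<noteq> 0"
proof
  assume "1 - cnj w * z = 0"
  then have "norm (cnj w * z) = 1" by (metis norm_one right_minus_eq)
  then have "norm w * norm z = 1" by (simp add: norm_mult)
  moreover have "norm w * norm z \<le> norm w * 1"
    using assms by (intro mult_left_mono) auto
  ultimately show False using assms by auto
qed

text \<open>As in Rouche's theorem, \<open>z ^ n\<close> dominates \<open>\<phi>\<close> on the
  circle, so their difference has at most \<open>n\<close> zeros in the disc. One zero more would
  yield a function with positive real part on the circle and value 0 at the centre, against the
  maximum principle.\<close>

lemma card_agree_power_le:
  assumes U: "open U" "cball 0 1 \<subseteq> U" and phi: "\<phi> holomorphic_on U"
    and less: "\<And>z. norm z = 1 \<Longrightarrow> norm (\<phi> z) < 1"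
    and A: "finite A" "A \<subseteq> ball 0 1" "\<And>z. z \<in> A \<Longrightarrow> \<phi> z = z ^ n"
  shows "card A \<le> n"
proof (rule ccontr)
  assume "\<not> card A \<le> n"
  then obtain S where S: "S \<subseteq> A" "finite S" "card S = Suc n"
    by (meson obtain_subset_with_card_n not_less_eq_eq)
  have SU: "S \<subseteq> U" using S(1) A(2) U(2) ball_subset_cball by blast
  obtain g where g: "g holomorphic_on U" "\<And>z. z \<in> U \<Longrightarrow> z ^ n - \<phi> z = g z * (\<Prod>s\<in>S. z - s)"
    by (rule holomorphic_divide_zeros[of U "\<lambda>z. z ^ n - \<phi> z" S])
       (use U(1) phi S A SU in \<open>auto intro!: holomorphic_intros\<close>)
  \<comment> \<open>On the unit circle \<open>z g / Q\<close> equals \<open>(z\<^sup>n - \<phi>) / (z\<^sup>n |Q|\<^sup>2)\<close>, which has positive real part;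
    but \<open>z g / Q\<close> vanishes at 0.\<close>
  define Q where "Q = (\<lambda>z. \<Prod>s\<in>S. 1 - cnj s * z)"
  have Q0: "Q z \<noteq> 0" if "norm z \<le> 1" for z
    unfolding Q_def using S A(2) that one_minus_cnj_mult_nonzero[of _ z] by auto
  define k where "k = (\<lambda>z. z * g z / Q z)"
  have k: "k holomorphic_on cball 0 1"
    unfolding k_def using Q0 holomorphic_on_subset[OF g(1) U(2)]
    by (auto intro!: holomorphic_intros simp: Q_def)
  have "0 < Re (k z)" if z: "norm z = 1" for z
  proof -
    have zz: "z * cnj z = 1" using z by (simp add: complex_norm_square[symmetric])
    have "z - s = z * cnj (1 - cnj s * z)" for s
    proof -
      have "z * cnj (1 - cnj s * z) = z - s * (z * cnj z)" by (simp add: algebra_simps)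
      then show ?thesis by (simp add: zz)
    qed
    \<comment> \<open>The exponent is the number of zeros. Being one larger than \<open>n\<close>,
      it leaves a single factor \<open>z\<close> after division by \<open>z ^ n\<close>, the factor
      that makes \<open>k\<close> vanish at 0.\<close>
    then have "(\<Prod>s\<in>S. z - s) = z ^ Suc n * cnj (Q z)"
      using S(3) by (simp add: Q_def prod.distrib)
    then have "z ^ n - \<phi> z = g z * (z ^ Suc n * cnj (Q z))"
      using g(2)[of z] U z by (simp add: subset_eq)
    then have "cnj z ^ n * (z ^ n - \<phi> z) = (cnj z * z) ^ n * (z * g z * cnj (Q z))"
      by (simp add: power_mult_distrib)
    then have *: "1 - cnj z ^ n * \<phi> z = z * g z * cnj (Q z)"
      using zz by (simp add: algebra_simps flip: power_mult_distrib)
    have "k z = z * g z * cnj (Q z) / (Q z * cnj (Q z))"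
      using Q0[of z] z by (simp add: k_def)
    also have "\<dots> = (1 - cnj z ^ n * \<phi> z) / of_real ((norm (Q z))\<^sup>2)"
      by (simp only: * complex_norm_square)
    finally have k: "k z = (1 - cnj z ^ n * \<phi> z) / of_real ((norm (Q z))\<^sup>2)" .
    have "norm (cnj z ^ n * \<phi> z) < 1" using less[OF z] z by (simp add: norm_mult norm_power)
    then have "0 < Re (1 - cnj z ^ n * \<phi> z)"
      using complex_Re_le_cmod[of "cnj z ^ n * \<phi> z"] by simp
    then show ?thesis
      unfolding k Re_divide_of_real using Q0[of z] z by simp
  qed
  moreover have "continuous_on (sphere 0 1) (\<lambda>z. norm (exp (- k z)))"
    using holomorphic_on_imp_continuous_on[OF k]
    by (intro continuous_intros) (auto elim: continuous_on_subset)
  then obtain w where w: "norm w = 1" "\<And>z. norm z = 1 \<Longrightarrow> norm (exp (- k z)) \<le> norm (exp (- k w))"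
    using continuous_attains_sup[of "sphere (0::complex) 1" "\<lambda>z. norm (exp (- k z))"]
    by fastforce
  \<comment> \<open>The exponential turns real parts into moduli: \<open>exp (- k z)\<close> has
    modulus 1 at 0 but less than 1 on the circle.\<close>
  have "norm (exp (- k 0)) \<le> norm (exp (- k w))"
  proof (rule maximum_modulus_frontier[where S = "cball 0 1" and f = "\<lambda>z. exp (- k z)"])
    show "(\<lambda>z. exp (- k z)) holomorphic_on interior (cball 0 1)"
      using holomorphic_on_subset[OF k, of "ball 0 1"] by (auto intro!: holomorphic_intros)
    show "continuous_on (closure (cball 0 1)) (\<lambda>z. exp (- k z))"
      using holomorphic_on_imp_continuous_on[OF k] by (auto intro!: continuous_intros)
  qed (use w in auto)
  then have "1 \<le> exp (- Re (k w))" by (simp add: k_def)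
  ultimately show False using w(1) by fastforce
qed

section \<open>Schwarz-Pick estimates and restriction to complex lines\<close>

text \<open>Schwarz's lemma for \<open>g\<close> followed by the disc automorphism that moves
  \<open>g 0\<close> to 0. The cross-multiplied form survives passage to limits of modulus 1, where
  the denominator may vanish.\<close>

lemma schwarz_pick_open:
  assumes g: "g holomorphic_on ball 0 1" and less: "\<And>z. norm z < 1 \<Longrightarrow> norm (g z) < 1"
    and w: "norm w < 1"
  shows "norm (g w - g 0) \<le> norm (1 - cnj (g 0) * g w) * norm w"
proof -
  have g0: "norm (g 0) < 1" using less by simp
  define M where "M = Moebius_function 0 (g 0)"
  have "(M \<circ> g) holomorphic_on ball 0 1"
    unfolding M_def using less
    by (intro holomorphic_on_compose_gen[OF g Moebius_function_holomorphic[OF g0]]) auto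
  moreover have "norm ((M \<circ> g) z) < 1" if "norm z < 1" for z
    using Moebius_function_norm_lt_1[OF g0 less[OF that]] by (simp add: M_def)
  moreover have "(M \<circ> g) 0 = 0" by (simp add: M_def Moebius_function_eq_zero)
  ultimately have "norm ((M \<circ> g) w) \<le> norm w"
    using Schwarz_Lemma(1) w by blast
  moreover have "1 - cnj (g 0) * g w \<noteq> 0"
    using one_minus_cnj_mult_nonzero g0 less[OF w] by simp
  ultimately show ?thesis
    by (simp add: M_def Moebius_function_simple norm_divide divide_simps mult.commute)
qed

text \<open>The radius \<open>r\<close> serves the slices of the domain in the second variable; the
  weak bound on \<open>g\<close> allows unimodular constants, which quotients from Schwarz's lemma
  can be.\<close>

lemma schwarz_pick:
  assumes g: "g holomorphic_on ball 0 r" and le: "\<And>z. norm z < r \<Longrightarrow> norm (g z) \<le> 1"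
    and r: "0 < r" and w: "norm w < r"
  shows "norm (g w - g 0) \<le> norm (1 - cnj (g 0) * g w) * (norm w / r)"
proof -
  \<comment> \<open>Scaling by \<open>t < 1\<close> makes the bound on \<open>g\<close> strict.\<close>
  define h where "h = (\<lambda>t::real. \<lambda>z. of_real t * g (of_real r * z))"
  have rz: "norm (of_real r * z) < r" if "norm z < 1" for z :: complex
    using that r by (simp add: norm_mult)
  have "norm (h t (w / r) - h t 0) \<le> norm (1 - cnj (h t 0) * h t (w / r)) * norm (w / r)"
    if t: "0 < t" "t < 1" for t
  proof (rule schwarz_pick_open)
    have "(g \<circ> (\<lambda>z. of_real r * z)) holomorphic_on ball 0 1"
      using rz by (intro holomorphic_on_compose_gen[OF _ g]) (auto intro!: holomorphic_intros)
    then show "h t holomorphic_on ball 0 1"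
      unfolding h_def by (auto intro!: holomorphic_intros simp: o_def)
    show "norm (h t z) < 1" if "norm z < 1" for z
    proof -
      have "t * norm (g (of_real r * z)) \<le> t * 1"
        using le[OF rz[OF that]] t by (intro mult_left_mono) auto
      then have "t * norm (g (of_real r * z)) < 1" using t by linarith
      then show ?thesis using t by (simp add: h_def norm_mult)
    qed
    show "norm (w / r) < 1" using w r by (simp add: norm_divide)
  qed
  then have ev: "\<forall>\<^sub>F t in at_left 1.
      norm (h t (w / r) - h t 0) \<le> norm (1 - cnj (h t 0) * h t (w / r)) * norm (w / r)"
    by (intro eventually_at_leftI[of 0]) auto
  have lim: "((\<lambda>t. h t z) \<longlongrightarrow> h 1 z) (at_left 1)" for z
    unfolding h_def by (intro tendsto_intros)
  have "norm (h 1 (w / r) - h 1 0) \<le> norm (1 - cnj (h 1 0) * h 1 (w / r)) * norm (w / r)"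
    by (rule tendsto_le[OF _ _ _ ev]) (auto intro!: tendsto_intros lim)
  then show ?thesis using r by (simp add: h_def norm_divide)
qed

text \<open>The chain rule gives the real derivative \<open>L (s *s v)\<close>, and complex
  linearity turns it into multiplication by \<open>L v\<close>.\<close>

lemma holomorphic_fun_on_slice:
  fixes F :: "complex ^ 'n \<Rightarrow> complex"
  assumes "holomorphic_fun_on F D" and S: "\<And>s. s \<in> S \<Longrightarrow> p + s *s v \<in> D"
  shows "(\<lambda>s. F (p + s *s v)) holomorphic_on S"
  unfolding holomorphic_on_def field_differentiable_def
proof
  fix s assume "s \<in> S"
  then obtain L where L: "(F has_derivative L) (at (p + s *s v) within D)"
      "\<And>c v. L (c *s v) = c * L v"
    using assms unfolding holomorphic_fun_on_def by metis
  have "linear (\<lambda>s. s *s v)"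
    by (rule linearI) (simp_all add: vec_eq_iff algebra_simps)
  then have "((\<lambda>s. p + s *s v) has_derivative (\<lambda>s. s *s v)) (at s within S)"
    by (auto intro!: derivative_eq_intros bounded_linear_imp_has_derivative
        simp: linear_conv_bounded_linear)
  moreover have "(F has_derivative L) (at (p + s *s v) within (\<lambda>s. p + s *s v) ` S)"
    using L(1) S by (auto intro: has_derivative_subset)
  ultimately have "((\<lambda>s. F (p + s *s v)) has_derivative (\<lambda>s. L (s *s v))) (at s within S)"
    using has_derivative_in_compose by blast
  then show "\<exists>d. ((\<lambda>s. F (p + s *s v)) has_field_derivative d) (at s within S)"
    unfolding has_field_derivative_def L(2) by (metis mult.commute mult_commute_abs)
qed

section \<open>Blaschke products with high contact at the origin\<close>

text \<open>The bound forces a zero at 0, and dividing by \<open>z\<close> lowers the exponent by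
  one. Leaving 0 out of the hypothesis lets the bound survive this division.\<close>

lemma poly_bound_imp_monom_dvd:
  fixes p :: "complex poly"
  assumes "\<And>z. 0 < norm z \<Longrightarrow> norm z < 1 \<Longrightarrow> norm (poly p z) \<le> C * norm z ^ n"
  shows "monom 1 n dvd p"
  using assms
proof (induction n arbitrary: p)
  case 0
  then show ?case by simp
next
  case (Suc n)
  have "norm (poly p 0) \<le> C * norm (0::complex) ^ Suc n"
  proof (rule tendsto_le[of "at 0"])
    show "((\<lambda>z. norm (poly p z)) \<longlongrightarrow> norm (poly p 0)) (at 0)"
      by (intro tendsto_intros)
    show "((\<lambda>z::complex. C * norm z ^ Suc n) \<longlongrightarrow> C * norm (0::complex) ^ Suc n) (at 0)"
      by (intro tendsto_intros)
    show "\<forall>\<^sub>F z in at 0. norm (poly p z) \<le> C * norm z ^ Suc n"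
      unfolding eventually_at by (rule exI[of _ 1]) (use Suc.prems in auto)
  qed simp
  then have "poly p 0 = 0" by simp
  then obtain q where q: "p = [:0, 1:] * q"
    by (metis dvdE minus_zero poly_eq_0_iff_dvd)
  have "monom 1 n dvd q"
  proof (rule Suc.IH)
    fix z :: complex assume z: "0 < norm z" "norm z < 1"
    show "norm (poly q z) \<le> C * norm z ^ n"
      using Suc.prems[OF z] z by (simp add: q norm_mult)
  qed
  then have "[:0, 1:] * monom 1 n dvd [:0, 1:] * q"
    by (rule mult_dvd_mono[OF dvd_refl])
  then show ?case
    by (simp add: q monom_Suc)
qed

lemma poly_eq_on_circle:
  fixes p q :: "complex poly"
  assumes "\<And>z. norm z = 1 \<Longrightarrow> poly p z = poly q z"
  shows "p = q"
proof (rule ccontr)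
  assume "p \<noteq> q"
  then have "finite {z. poly (p - q) z = 0}"
    by (intro poly_roots_finite) auto
  moreover have "sphere (0::complex) 1 \<subseteq> {z. poly (p - q) z = 0}"
    using assms by auto
  ultimately have "finite (sphere (0::complex) 1)" using finite_subset by blast
  \<comment> \<open>A finite connected set has at most one point, so the circle is infinite.\<close>
  moreover have "connected (sphere (0::complex) 1)"
    by (rule connected_sphere) simp
  ultimately have "sphere (0::complex) 1 = {} \<or> (\<exists>x. sphere (0::complex) 1 = {x})"
    by (simp add: connected_finite_iff_sing)
  moreover have "1 \<in> sphere (0::complex) 1" "- 1 \<in> sphere (0::complex) 1" by auto
  ultimately show False
    by (metis empty_iff singletonD one_neq_neg_one)
qed

text \<open>After moving \<open>B 0\<close> to 0, the numerator has degree at most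
  \<open>n + 1\<close> and is divisible by \<open>z ^ n\<close>, so one linear factor remains.
  Reflection in the circle determines the denominator from it, and the quotient
  \<open>\<psi>\<close> is explicit enough to compute its derivative at 0.\<close>

lemma blaschke_contact_order:
  fixes \<alpha> :: "nat \<Rightarrow> complex" and \<zeta> :: complex and k :: nat
  defines "B \<equiv> \<lambda>z. \<zeta> * (\<Prod>j=1..k. disc_moebius (\<alpha> j) z)"
  assumes zeta: "norm \<zeta> = 1" and alpha: "\<forall>j\<in>{1..k}. \<alpha> j \<in> unit_disc" and k: "k \<le> Suc n"
    and less: "\<And>z. norm z < 1 \<Longrightarrow> norm (B z) < 1"
    and contact: "\<And>z. norm z < 1 \<Longrightarrow>
      norm (B z - B 0) \<le> norm (1 - cnj (B 0) * B z) * norm z ^ n"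
  obtains \<psi> d where "(\<psi> has_field_derivative d) (at 0)"
    "\<And>z. norm z < 1 \<Longrightarrow> disc_moebius (B 0) (B z) = z ^ n * \<psi> z"
    "1 - (norm (\<psi> 0))\<^sup>2 \<le> norm d"
proof -
  define c where "c = B 0"
  \<comment> \<open>On the disc \<open>B = P / Q\<close>, and \<open>N / E\<close> is
    \<open>disc_moebius c\<close> applied to \<open>B\<close>.\<close>
  define P where "P = smult \<zeta> (\<Prod>j=1..k. [:- \<alpha> j, 1:])"
  define Q where "Q = (\<Prod>j=1..k. [:1, - cnj (\<alpha> j):])"
  define N where "N = P - smult c Q"
  define E where "E = Q - smult (cnj c) P"
  have c: "norm c < 1" using less by (simp add: c_def)
  have Q0: "poly Q z \<noteq> 0" if "norm z < 1" for z
    using alpha that one_minus_cnj_mult_nonzero[of _ z]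
    by (auto simp: Q_def poly_prod mult.commute)
  have PQ: "poly P z = poly Q z * B z" if "norm z < 1" for z
  proof -
    have "poly P z / poly Q z = B z"
      by (simp add: P_def Q_def B_def poly_prod disc_moebius_def mult.commute prod_dividef)
    then show ?thesis using Q0[OF that] by (simp add: field_simps)
  qed
  have NE: "poly N z = poly Q z * (B z - c)" "poly E z = poly Q z * (1 - cnj c * B z)"
    if "norm z < 1" for z
    using PQ[OF that] by (simp_all add: N_def E_def algebra_simps)
  have E0: "poly E z \<noteq> 0" if "norm z < 1" for z
    using NE(2)[OF that] Q0[OF that] c less[OF that] one_minus_cnj_mult_nonzero[of c "B z"]
    by simp
  have degP: "degree P \<le> k"
  proof -
    have "degree P \<le> degree (\<Prod>j=1..k. [:- \<alpha> j, 1:])" by (simp add: P_def)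
    also have "\<dots> \<le> (\<Sum>j=1..k. degree [:- \<alpha> j, 1:])"
      using degree_prod_sum_le[of "{1..k}" "\<lambda>j. [:- \<alpha> j, 1:]"] by (simp add: o_def)
    also have "\<dots> = k" by simp
    finally show ?thesis .
  qed
  have degQ: "degree Q \<le> k"
  proof -
    have "degree Q \<le> (\<Sum>j=1..k. degree [:1, - cnj (\<alpha> j):])"
      unfolding Q_def
      using degree_prod_sum_le[of "{1..k}" "\<lambda>j. [:1, - cnj (\<alpha> j):]"] by (simp add: o_def)
    also have "\<dots> \<le> (\<Sum>j=1..k. 1)" by (intro sum_mono) simp
    finally show ?thesis by simp
  qed
  have degN: "degree N \<le> Suc n"
    using degP degQ k unfolding N_def
    by (intro degree_diff_le) (auto intro: order_trans[OF degree_smult_le])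
  \<comment> \<open>Multiplied by \<open>norm (poly Q z)\<close>, the contact estimate bounds
    \<open>N\<close> by \<open>E\<close> times \<open>norm z ^ n\<close>, and \<open>E\<close> is
    bounded on the disc.\<close>
  have "monom 1 n dvd N"
  proof -
    have "bounded (poly E ` cball 0 1)"
      by (intro compact_imp_bounded compact_continuous_image continuous_intros) auto
    then obtain C where C: "\<And>z. norm z \<le> 1 \<Longrightarrow> norm (poly E z) \<le> C"
      unfolding bounded_iff by (metis imageI mem_cball_0)
    have "norm (poly N z) \<le> C * norm z ^ n" if z: "norm z < 1" for z
    proof -
      have "norm (poly N z) \<le> norm (poly Q z) * (norm (1 - cnj c * B z) * norm z ^ n)"
        using contact[OF z] by (simp add: NE[OF z] norm_mult c_def mult_left_mono)
      also have "\<dots> = norm (poly E z) * norm z ^ n"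
        by (simp add: NE[OF z] norm_mult)
      also have "\<dots> \<le> C * norm z ^ n"
        using C z by (intro mult_right_mono) auto
      finally show ?thesis .
    qed
    then show ?thesis by (intro poly_bound_imp_monom_dvd)
  qed
  then obtain M where M: "N = monom 1 n * M" by blast
  have "degree M \<le> 1"
  proof (cases "M = 0")
    case False
    then have "degree N = n + degree M"
      by (simp add: M degree_mult_eq degree_monom_eq)
    then show ?thesis using degN by simp
  qed simp
  obtain u p where "M = pCons u p" by (rule pCons_cases)
  moreover from this have "degree p = 0"
    using \<open>degree M \<le> 1\<close> by (auto split: if_splits)
  ultimately obtain v where uv: "M = [:u, v:]" by (metis degree_eq_zeroE)
  \<comment> \<open>On the unit circle \<open>z\<^sup>k\<close> times the conjugate of \<open>N\<close> is \<open>E\<close> up to a unimodular factor,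
    so the reflection of \<open>M\<close> gives \<open>E\<close> explicitly.\<close>
  have refl: "monom 1 (Suc n - k) * E = [:\<zeta> * cnj v, \<zeta> * cnj u:]"
  proof (rule poly_eq_on_circle)
    fix z :: complex assume "norm z = 1"
    then have zz: "z * cnj z = 1" by (simp add: complex_norm_square[symmetric])
    have zeta': "\<zeta> * cnj \<zeta> = 1" using zeta by (simp add: complex_norm_square[symmetric])
    have "1 - cnj (\<alpha> j) * z = z * cnj (z - \<alpha> j)" for j
      using zz by (simp add: algebra_simps)
    then have "poly Q z = z ^ k * cnj (\<Prod>j=1..k. z - \<alpha> j)"
      by (simp add: Q_def poly_prod prod.distrib mult.commute)
    moreover have P: "poly P z = \<zeta> * (\<Prod>j=1..k. z - \<alpha> j)"
      by (simp add: P_def poly_prod)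
    ultimately have Q: "poly Q z = \<zeta> * z ^ k * cnj (poly P z)"
      using zeta' by (simp add: algebra_simps)
    then have "\<zeta> * z ^ k * cnj (poly Q z) = (\<zeta> * cnj \<zeta>) * (z * cnj z) ^ k * poly P z"
      by (simp add: power_mult_distrib)
    then have P: "poly P z = \<zeta> * z ^ k * cnj (poly Q z)"
      using zz zeta' by simp
    have "poly E z = poly Q z - cnj c * poly P z" by (simp add: E_def)
    also have "\<dots> = \<zeta> * z ^ k * cnj (poly P z) - cnj c * (\<zeta> * z ^ k * cnj (poly Q z))"
      using P Q by argo
    also have "\<dots> = \<zeta> * z ^ k * cnj (poly N z)"
      by (simp add: N_def algebra_simps)
    finally have "z ^ (Suc n - k) * poly E z = \<zeta> * z ^ (Suc n - k + k) * cnj (poly N z)"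
      by (simp add: power_add)
    also have "\<dots> = \<zeta> * (z * (z * cnj z) ^ n * cnj (u + v * z))"
      using k by (simp add: M uv poly_monom power_mult_distrib algebra_simps)
    also have "\<dots> = \<zeta> * cnj u * z + \<zeta> * cnj v * (z * cnj z)"
      using zz by (simp add: algebra_simps)
    finally show "poly (monom 1 (Suc n - k) * E) z = poly [:\<zeta> * cnj v, \<zeta> * cnj u:] z"
      using zz by (simp add: poly_monom algebra_simps)
  qed
  define \<psi> where "\<psi> = (\<lambda>z. (u + v * z) / poly E z)"
  have eq: "disc_moebius (B 0) (B z) = z ^ n * \<psi> z" if "norm z < 1" for z
  proof -
    have "disc_moebius (B 0) (B z) = poly N z / poly E z"
      using Q0[OF that] by (simp add: disc_moebius_def NE[OF that] flip: c_def)
    then show ?thesis by (simp add: \<psi>_def M uv poly_monom algebra_simps)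
  qed
  \<comment> \<open>The cases follow the gap between \<open>k\<close> and \<open>n + 1\<close>. Gap
    0 makes \<open>\<psi>\<close> a quotient of linear polynomials, gap 1 a unimodular constant. A
    larger gap would put a factor \<open>z ^ 2\<close> on the left of \<open>refl\<close>, whose
    right side is linear, although \<open>E\<close> has no zero at 0.\<close>
  consider "Suc n - k = 0" | "Suc n - k = 1" | j where "Suc n - k = Suc (Suc j)"
    by (metis One_nat_def not0_implies_Suc)
  then show thesis
  proof cases
    case 1
    then have E: "poly E = (\<lambda>z. \<zeta> * (cnj v + cnj u * z))"
      using refl by (simp add: fun_eq_iff algebra_simps)
    have v: "v \<noteq> 0" "\<zeta> \<noteq> 0" using E0[of 0] by (auto simp: E)
    \<comment> \<open>The quotient rule at 0 for
      \<open>(u + v * z) / (\<zeta> * (cnj v + cnj u * z))\<close>.\<close>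
    define d where "d = (v * cnj v - u * cnj u) / (\<zeta> * (cnj v)\<^sup>2)"
    have "(\<psi> has_field_derivative d) (at 0)"
      unfolding \<psi>_def E d_def using v
      by (auto intro!: derivative_eq_intros simp: power2_eq_square field_simps)
    moreover have "1 - (norm (\<psi> 0))\<^sup>2 \<le> norm d"
    proof -
      have "norm d = \<bar>(norm v)\<^sup>2 - (norm u)\<^sup>2\<bar> / (norm v)\<^sup>2"
        unfolding d_def norm_divide norm_mult norm_power complex_norm_square[symmetric]
        by (simp add: zeta flip: of_real_diff of_real_power)
      moreover have "norm (\<psi> 0) = norm u / norm v"
        by (simp add: \<psi>_def E norm_divide norm_mult zeta)
      then have "1 - (norm (\<psi> 0))\<^sup>2 = ((norm v)\<^sup>2 - (norm u)\<^sup>2) / (norm v)\<^sup>2"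
        using v by (simp add: power_divide diff_divide_distrib)
      ultimately show ?thesis
        by (simp add: divide_right_mono)
    qed
    ultimately show thesis using that eq by blast
  next
    case 2
    then have "pCons 0 E = [:\<zeta> * cnj v, \<zeta> * cnj u:]"
      using refl by (simp add: monom_Suc monom_0)
    then have E: "E = [:\<zeta> * cnj u:]" and "\<zeta> * cnj v = 0" by auto
    then have "u \<noteq> 0" "v = 0" using E0[of 0] zeta by auto
    then have "\<psi> = (\<lambda>z. u / (\<zeta> * cnj u))" "norm (u / (\<zeta> * cnj u)) = 1"
      using zeta by (simp_all add: \<psi>_def E norm_divide norm_mult)
    then show thesis using that[of \<psi> 0] eq by simp
  next
    case 3
    then have "poly E 0 = 0"
      using refl by (simp add: monom_Suc)
    then show thesis using E0[of 0] by simp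
  qed
qed

section \<open>Upper bound for the derivative at the origin\<close>

text \<open>Letting z tend to 0 in \<open>near\<close> gives \<open>\<psi> 0 = a * R 0\<close>. The
  difference quotient of \<open>\<psi>\<close> then splits into the error from \<open>near\<close>,
  with limit \<open>1 - a\<close>, and a Schwarz-Pick term for \<open>R\<close>, with limit
  \<open>a * (1 - (norm (R 0))\<^sup>2) * a\<close>, which equals
  \<open>a\<^sup>2 - (norm (\<psi> 0))\<^sup>2\<close>.\<close>

lemma derivative_bound_of_near_power_lift:
  fixes \<psi> R :: "complex \<Rightarrow> complex"
  assumes a: "0 < a" "a < 1" and n: "0 < n"
    and psi: "(\<psi> has_field_derivative d) (at 0)"
    and R: "R holomorphic_on ball 0 1" "\<And>z. norm z < 1 \<Longrightarrow> norm (R z) \<le> 1"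
    and near: "\<And>z. 0 < norm z \<Longrightarrow> norm z < 1 \<Longrightarrow>
      norm (\<psi> z - of_real a * R (of_real a * z ^ n))
        \<le> (1 + norm z ^ n) * ((1 - a) * norm z / (1 - a * norm z ^ n))"
  shows "norm d \<le> 1 - a + a\<^sup>2 - (norm (\<psi> 0))\<^sup>2"
proof -
  have small: "norm (of_real a * z ^ n) < 1" "a * norm z ^ n < 1" if "norm z < 1" for z :: complex
  proof -
    have "a * norm z ^ n \<le> a * 1"
      using a that by (intro mult_left_mono power_le_one) auto
    then show "a * norm z ^ n < 1" using a by linarith
    then show "norm (of_real a * z ^ n) < 1" using a by (simp add: norm_mult norm_power)
  qed
  have pow: "((\<lambda>z::complex. of_real a * z ^ n) \<longlongrightarrow> 0) (at 0)"
    using n by (auto intro!: tendsto_eq_intros)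
  have "isCont R 0"
    using R(1) by (meson centre_in_ball continuous_on_eq_continuous_at holomorphic_on_imp_continuous_on open_ball zero_less_one)
  then have Rlim: "((\<lambda>z. R (of_real a * z ^ n)) \<longlongrightarrow> R 0) (at 0)"
    using pow isCont_tendsto_compose by blast
  have plim: "(\<psi> \<longlongrightarrow> \<psi> 0) (at 0)"
    using psi DERIV_isCont isContD by blast
  have ev: "\<forall>\<^sub>F z::complex in at 0. 0 < norm z \<and> norm z < 1"
    unfolding eventually_at by (rule exI[of _ 1]) auto
  have npow: "((\<lambda>z::complex. norm z ^ n) \<longlongrightarrow> 0) (at 0)"
    using n by (auto intro!: tendsto_eq_intros)
  have "norm (\<psi> 0 - of_real a * R 0) \<le> (1 + 0) * ((1 - a) * 0 / (1 - a * 0))"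
  proof (rule tendsto_le[of "at (0::complex)"])
    show "((\<lambda>z. norm (\<psi> z - of_real a * R (of_real a * z ^ n))) \<longlongrightarrow> norm (\<psi> 0 - of_real a * R 0)) (at 0)"
      by (intro tendsto_intros plim Rlim)
    show "((\<lambda>z. (1 + norm z ^ n) * ((1 - a) * norm z / (1 - a * norm z ^ n)))
        \<longlongrightarrow> (1 + 0) * ((1 - a) * 0 / (1 - a * 0))) (at (0::complex))"
      by (intro tendsto_intros npow tendsto_norm_zero) auto
  qed (use ev near in \<open>auto elim: eventually_mono\<close>)
  then have psi0: "\<psi> 0 = of_real a * R 0" by simp
  have "norm d \<le> (1 + 0) * ((1 - a) / (1 - a * 0)) + a * (norm (1 - cnj (R 0) * R 0) * a)"
  proof (rule tendsto_le[of "at (0::complex)"])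
    show "((\<lambda>z. norm ((\<psi> z - \<psi> 0) / z)) \<longlongrightarrow> norm d) (at 0)"
      using psi by (intro tendsto_norm) (simp add: has_field_derivative_iff)
    show "((\<lambda>z. (1 + norm z ^ n) * ((1 - a) / (1 - a * norm z ^ n))
          + a * (norm (1 - cnj (R 0) * R (of_real a * z ^ n)) * a))
        \<longlongrightarrow> (1 + 0) * ((1 - a) / (1 - a * 0)) + a * (norm (1 - cnj (R 0) * R 0) * a)) (at (0::complex))"
      by (intro tendsto_intros npow Rlim) auto
    show "\<forall>\<^sub>F z in at 0. norm ((\<psi> z - \<psi> 0) / z) \<le> (1 + norm z ^ n) * ((1 - a) / (1 - a * norm z ^ n))
          + a * (norm (1 - cnj (R 0) * R (of_real a * z ^ n)) * a)"
      using ev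
    proof eventually_elim
      case (elim z)
      let ?w = "of_real a * z ^ n"
      \<comment> \<open>Sharp for \<open>n = 1\<close> and lossy for larger \<open>n\<close>, but it
        gives one bound for all \<open>n\<close>.\<close>
      have "norm z ^ n \<le> norm z ^ 1" using elim n by (intro power_decreasing) auto
      then have "norm ?w \<le> a * norm z"
        using a by (simp add: norm_mult norm_power)
      then have "norm (R ?w - R 0) \<le> norm (1 - cnj (R 0) * R ?w) * (a * norm z)"
        using schwarz_pick[OF R zero_less_one small(1)[of z]] elim
        by (simp add: mult_left_mono order_trans)
      then have "a * norm (R ?w - R 0) \<le> a * (norm (1 - cnj (R 0) * R ?w) * (a * norm z))"
        using a by simp
      then have "norm (of_real a * R ?w - \<psi> 0) \<le> a * (norm (1 - cnj (R 0) * R ?w) * (a * norm z))"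
        using a by (simp add: psi0 norm_mult flip: right_diff_distrib)
      then have "norm (\<psi> z - \<psi> 0) \<le> (1 + norm z ^ n) * ((1 - a) * norm z / (1 - a * norm z ^ n))
          + a * (norm (1 - cnj (R 0) * R ?w) * (a * norm z))"
        using near elim by (intro norm_diff_triangle_le) auto
      also have "\<dots> = ((1 + norm z ^ n) * ((1 - a) / (1 - a * norm z ^ n))
          + a * (norm (1 - cnj (R 0) * R ?w) * a)) * norm z"
        by (simp add: algebra_simps)
      finally show ?case
        using elim by (simp add: norm_divide divide_le_eq)
    qed
  qed simp
  also have "norm (1 - cnj (R 0) * R 0) = 1 - (norm (R 0))\<^sup>2"
  proof -
    have "1 - cnj (R 0) * R 0 = of_real (1 - (norm (R 0))\<^sup>2)"
      using complex_norm_square[of "R 0"] by (simp add: mult.commute)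
    moreover have "(norm (R 0))\<^sup>2 \<le> 1" using R(2)[of 0] by (simp add: power_le_one)
    ultimately show ?thesis by (simp only: norm_of_real)
  qed
  finally show ?thesis
    using a by (simp add: psi0 norm_mult power_mult_distrib power2_eq_square algebra_simps)
qed

lemma vector_2_add_smult:
  "vector [x, y] + s *s vector [v, w] = (vector [x + s * v, y + s * w] :: complex ^ 2)"
  by (simp add: vec_eq_iff forall_2)

text \<open>Schwarz's lemma on the first axis writes the normalised function there as
  \<open>x * R x\<close>. Schwarz-Pick in the second variable, on the disc of radius
  \<open>1 - norm x\<close>, bounds the cost of leaving the axis; dividing by
  \<open>norm z ^ n\<close> gives the hypothesis \<open>near\<close> of the previous
  estimate.\<close>

lemma slice_derivative_bound:
  fixes F :: "complex ^ 2 \<Rightarrow> complex" and D :: "(complex ^ 2) set"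
  assumes a: "0 < a" "a < 1" and n: "0 < n"
    and D: "D = {z. norm (z $ 1) + norm (z $ 2) < 1}"
    and F: "holomorphic_fun_on F D" "F ` D \<subseteq> unit_disc"
    and psi: "(\<psi> has_field_derivative d) (at 0)"
    and eq: "\<And>z. norm z < 1 \<Longrightarrow> disc_moebius (F 0)
      (F (vector [of_real a * z ^ n, of_real (1 - a) * z ^ Suc n])) = z ^ n * \<psi> z"
  shows "norm d \<le> 1 - a + a\<^sup>2 - (norm (\<psi> 0))\<^sup>2"
proof -
  have D_iff: "vector [x, y] \<in> D \<longleftrightarrow> norm x + norm y < 1" for x y :: complex
    by (simp add: D)
  have zero: "(vector [0, 0] :: complex ^ 2) = 0" by (simp add: vec_eq_iff forall_2)
  have F0: "norm (F 0) < 1" using F(2) D_iff[of 0 0] by (auto simp: zero)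
  define \<Phi> where "\<Phi> = (\<lambda>x y. Moebius_function 0 (F 0) (F (vector [x, y])))"
  have Phi_less: "norm (\<Phi> x y) < 1" if "norm x + norm y < 1" for x y
    unfolding \<Phi>_def using F(2) D_iff[of x y] that by (intro Moebius_function_norm_lt_1[OF F0]) auto
  have Phi_hol: "(\<lambda>s. \<Phi> (x + s * v) (y + s * w)) holomorphic_on S"
    if S: "\<And>s. s \<in> S \<Longrightarrow> norm (x + s * v) + norm (y + s * w) < 1" for x y v w S
  proof -
    have "(\<lambda>s. F (vector [x, y] + s *s vector [v, w])) holomorphic_on S"
      using S by (intro holomorphic_fun_on_slice[OF F(1)]) (simp add: vector_2_add_smult D_iff)
    then have "(Moebius_function 0 (F 0) \<circ> (\<lambda>s. F (vector [x, y] + s *s vector [v, w]))) holomorphic_on S"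
      using S F(2) D_iff
      by (intro holomorphic_on_compose_gen[OF _ Moebius_function_holomorphic[OF F0]])
         (auto simp: vector_2_add_smult)
    then show ?thesis by (simp add: o_def \<Phi>_def vector_2_add_smult)
  qed
  have Phi0: "\<Phi> 0 0 = 0" by (simp add: \<Phi>_def zero Moebius_function_eq_zero)
  have axis_hol: "(\<lambda>s. \<Phi> s 0) holomorphic_on ball 0 1"
    using Phi_hol[of "ball 0 1" 0 1 0 0] by simp
  obtain R where R: "R holomorphic_on ball 0 1" "\<And>z. norm z < 1 \<Longrightarrow> \<Phi> z 0 = z * R z"
    by (rule Schwarz3[OF axis_hol Phi0]) auto
  have R_off: "norm (R z) \<le> 1" if "norm z < 1" "z \<noteq> 0" for z
  proof -
    have "norm (\<Phi> z 0) \<le> norm z"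
      using Schwarz_Lemma(1)[OF axis_hol] Phi0 Phi_less that by simp
    then show ?thesis using R(2) that by (simp add: norm_mult)
  qed
  \<comment> \<open>Schwarz's lemma controls \<open>z * R z\<close> and says nothing about
    \<open>R 0\<close>, which is reached by continuity.\<close>
  have R_le: "norm (R z) \<le> 1" if "norm z < 1" for z
  proof (cases "z = 0")
    case True
    have "isCont R 0"
      using R(1) by (meson centre_in_ball continuous_on_eq_continuous_at holomorphic_on_imp_continuous_on open_ball zero_less_one)
    then have "((\<lambda>z. norm (R z)) \<longlongrightarrow> norm (R 0)) (at 0)"
      by (intro tendsto_norm isContD)
    moreover have "\<forall>\<^sub>F z in at 0. norm (R z) \<le> 1"
      unfolding eventually_at using R_off by (intro exI[of _ 1]) auto
    ultimately show ?thesis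
      using True tendsto_upperbound by fastforce
  qed (use R_off that in auto)
  show ?thesis
  proof (rule derivative_bound_of_near_power_lift[OF a n psi R(1) R_le])
    fix z :: complex assume z: "0 < norm z" "norm z < 1"
    define x where "x = of_real a * z ^ n"
    define y where "y = of_real (1 - a) * z ^ Suc n"
    have nx: "norm x = a * norm z ^ n" and ny: "norm y = (1 - a) * norm z * norm z ^ n"
      using a by (simp_all add: x_def y_def norm_mult norm_power del: of_real_diff)
    have zn: "0 < norm z ^ n" "norm z ^ n < 1"
      using z n by (simp_all add: power_less_one_iff)
    have "norm y < (1 - a) * 1"
    proof -
      have "norm z * norm z ^ n < 1 * 1" using z zn by (intro mult_strict_mono) auto
      then show ?thesis using a by (simp add: ny mult.assoc)
    qed
    moreover have "norm x < a * 1" unfolding nx using a zn by (intro mult_strict_left_mono) auto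
    ultimately have xy: "norm x < 1" "norm y < 1 - norm x" using a by simp_all
    have "norm (\<Phi> x y - \<Phi> x 0) \<le> norm (1 - cnj (\<Phi> x 0) * \<Phi> x y) * (norm y / (1 - norm x))"
    proof (rule schwarz_pick)
      show "(\<lambda>s. \<Phi> x s) holomorphic_on ball 0 (1 - norm x)"
        using Phi_hol[of "ball 0 (1 - norm x)" x 0 0 1] by simp
      show "norm (\<Phi> x s) \<le> 1" if "norm s < 1 - norm x" for s
        using Phi_less[of x s] that by simp
    qed (use xy in auto)
    \<comment> \<open>The value on the axis is at most \<open>norm z ^ n\<close>, so this factor
      tends to 1. The trivial bound 2 would lead to \<open>2 * (1 - a)\<close> in place of
      \<open>1 - a\<close>.\<close>
    also have "\<dots> \<le> (1 + norm z ^ n) * (norm y / (1 - norm x))"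
    proof (intro mult_right_mono)
      have "norm (\<Phi> x 0) \<le> norm x * 1"
        unfolding R(2)[OF xy(1)] norm_mult using R_le[OF xy(1)] by (intro mult_left_mono) auto
      also have "\<dots> \<le> norm z ^ n" using a zn by (simp add: nx mult_left_le_one_le)
      finally have "norm (\<Phi> x 0) * norm (\<Phi> x y) \<le> norm z ^ n * 1"
        using Phi_less[of x y] xy by (intro mult_mono) auto
      then show "norm (1 - cnj (\<Phi> x 0) * \<Phi> x y) \<le> 1 + norm z ^ n"
        using norm_triangle_ineq4[of 1 "cnj (\<Phi> x 0) * \<Phi> x y"] by (simp add: norm_mult)
    qed (use xy in auto)
    also have "norm y / (1 - norm x) = norm z ^ n * ((1 - a) * norm z / (1 - a * norm z ^ n))"
      by (simp add: nx ny)
    finally have *: "norm (\<Phi> x y - \<Phi> x 0)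
        \<le> norm z ^ n * ((1 + norm z ^ n) * ((1 - a) * norm z / (1 - a * norm z ^ n)))"
      by (simp only: mult.left_commute)
    have "\<Phi> x y = z ^ n * \<psi> z"
      using eq[OF z(2)] by (simp add: \<Phi>_def x_def y_def disc_moebius_def Moebius_function_simple)
    moreover have "\<Phi> x 0 = z ^ n * (of_real a * R x)"
      using R(2)[OF xy(1)] by (simp add: x_def)
    ultimately have "\<Phi> x y - \<Phi> x 0 = z ^ n * (\<psi> z - of_real a * R x)"
      by (simp add: right_diff_distrib)
    then have "norm (\<Phi> x y - \<Phi> x 0) = norm z ^ n * norm (\<psi> z - of_real a * R x)"
      by (simp add: norm_mult norm_power)
    then show "norm (\<psi> z - of_real a * R (of_real a * z ^ n))
        \<le> (1 + norm z ^ n) * ((1 - a) * norm z / (1 - a * norm z ^ n))"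
      using * zn(1) unfolding x_def by (simp only: mult_le_cancel_left_pos)
  qed
qed

section \<open>The map f is extremal but not geodesic\<close>

theorem proposition4p2:
  fixes m :: nat and a :: real
    and f :: "complex \<Rightarrow> complex ^ 2" and D :: "(complex ^ 2) set"
  assumes "m \<ge> 3" and "0 < a" and "a < 1"
    and "f = (\<lambda>z. vector [of_real a * z ^ (m - 2), of_real (1 - a) * z ^ (m - 1)])"
    and "D = {z. norm (z $ 1) + norm (z $ 2) < 1}"
  shows "m_extremal m D f \<and> \<not> m_geodesic m D f"
proof
  define n where "n = m - 2"
  have n: "0 < n" "m - 2 = n" "m - 1 = Suc n" "m = Suc (Suc n)"
    using assms(1) by (auto simp: n_def)
  have f: "f = (\<lambda>z. vector [of_real a * z ^ n, of_real (1 - a) * z ^ Suc n])"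
    using assms(4) n by simp
  have norm_one_minus: "norm (1 - complex_of_real a) = 1 - a"
    using assms(2,3) norm_of_real[of "1 - a"] by (simp del: norm_of_real)
  have hol: "holomorphic_map_on f unit_disc"
    unfolding holomorphic_map_on_def f forall_2 by (auto intro!: holomorphic_intros)
  have maps: "f ` unit_disc \<subseteq> D"
  proof clarify
    fix z :: complex assume "z \<in> unit_disc"
    then have "norm z ^ n < 1" "norm z ^ Suc n < 1"
      using n(1) by (simp_all add: power_less_one_iff del: power_Suc)
    then have "a * norm z ^ n + (1 - a) * norm z ^ Suc n < a * 1 + (1 - a) * 1"
      using assms(2,3) by (intro add_strict_mono mult_strict_left_mono) auto
    then show "f z \<in> D"
      using assms(2,3) by (simp add: f assms(5) norm_mult norm_power norm_one_minus)
  qed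
  show "m_extremal m D f"
    unfolding m_extremal_def weak_m_extremal_def
  proof (intro conjI allI impI hol maps notI)
    fix l assume l: "l ` {1..m} \<subseteq> unit_disc \<and> inj_on l {1..m}"
      and "\<exists>h\<in>holomorphic_near_closed_disc D. \<forall>j\<in>{1..m}. h (l j) = f (l j)"
    then obtain h U where U: "open U" "cball 0 1 \<subseteq> U" and h: "holomorphic_map_on h U"
        "h ` U \<subseteq> D" "\<forall>j\<in>{1..m}. h (l j) = f (l j)"
      unfolding holomorphic_near_closed_disc_def by blast
    \<comment> \<open>The factor \<open>z\<close> lifts the first component of \<open>f\<close> to
      degree \<open>n + 1\<close>; the weights \<open>a\<close> and \<open>1 - a\<close> then add up
      to exactly \<open>z ^ Suc n\<close>.\<close>
    define \<phi> where "\<phi> = (\<lambda>z. z * h z $ 1 + h z $ 2)"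
    have "card (l ` {1..m}) \<le> Suc n"
    proof (rule card_agree_power_le[OF U])
      show "\<phi> holomorphic_on U"
        using h(1) unfolding holomorphic_map_on_def \<phi>_def by (auto intro!: holomorphic_intros)
      show "norm (\<phi> z) < 1" if "norm z = 1" for z
      proof -
        have "norm (h z $ 1) + norm (h z $ 2) < 1"
          using h(2) U(2) that by (force simp: assms(5))
        moreover have "norm (\<phi> z) \<le> norm (h z $ 1) + norm (h z $ 2)"
          using norm_triangle_ineq[of "z * h z $ 1" "h z $ 2"] that by (simp add: \<phi>_def norm_mult)
        ultimately show ?thesis by simp
      qed
      show "\<phi> z = z ^ Suc n" if "z \<in> l ` {1..m}" for z
      proof -
        have "h z = f z" using h(3) that by blast
        then show ?thesis by (simp add: \<phi>_def f algebra_simps)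
      qed
    qed (use l in auto)
    then show False using l n(4) by (simp add: card_image)
  qed
  show "\<not> m_geodesic m D f"
  proof
    assume "m_geodesic m D f"
    then obtain F k where F: "holomorphic_fun_on F D" "F ` D \<subseteq> unit_disc"
        and k: "k \<le> Suc n" and B: "blaschke_product k (F \<circ> f)"
      unfolding m_geodesic_def n(3) by blast
    then obtain \<zeta> \<alpha> where zeta: "norm \<zeta> = 1" and alpha: "\<forall>j\<in>{1..k}. \<alpha> j \<in> unit_disc"
        and Ff: "\<forall>z\<in>unit_disc. (F \<circ> f) z = \<zeta> * (\<Prod>j=1..k. disc_moebius (\<alpha> j) z)"
      unfolding blaschke_product_def by blast
    define b where "b = (\<lambda>z. \<zeta> * (\<Prod>j=1..k. disc_moebius (\<alpha> j) z))"
    have Fb: "F (f z) = b z" if "norm z < 1" for z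
      using Ff that by (simp add: b_def)
    have "f 0 = 0" using n(1) by (simp add: f vec_eq_iff forall_2)
    then have b0: "b 0 = F 0" using Fb[of 0] by simp
    have less: "norm (b z) < 1" if "norm z < 1" for z
    proof -
      have "F (f z) \<in> unit_disc" using F(2) maps that by (simp add: image_subset_iff)
      then show ?thesis by (simp add: Fb[OF that])
    qed
    have contact: "norm (b z - b 0) \<le> norm (1 - cnj (b 0) * b z) * norm z ^ n"
      if z: "norm z < 1" for z
    proof -
      \<comment> \<open>For each \<open>z\<close> a separate complex line through 0 is used:
        \<open>f z\<close> lies on it at parameter \<open>z ^ n\<close>, and the open unit disc of
        parameters stays in \<open>D\<close>. Schwarz-Pick along this line gives the contact
        order.\<close>
      define v :: "complex ^ 2" where "v = vector [of_real a, of_real (1 - a) * z]"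
      have fz: "f z = 0 + z ^ n *s v"
        by (simp add: f v_def vec_eq_iff forall_2 algebra_simps)
      have mem: "0 + s *s v \<in> D" if "norm s < 1" for s
      proof -
        have "norm ((s *s v) $ 1) + norm ((s *s v) $ 2) = norm s * (a + (1 - a) * norm z)"
          using assms(2) by (simp add: v_def norm_mult norm_one_minus distrib_left)
        also have "\<dots> \<le> norm s * (a + (1 - a) * 1)"
          using assms(2,3) z by (intro mult_left_mono add_left_mono) auto
        finally show ?thesis using that by (simp add: assms(5))
      qed
      define g where "g = (\<lambda>s. F (0 + s *s v))"
      have g: "g holomorphic_on ball 0 1" "norm (g s) \<le> 1" if "norm s < 1" for s
        unfolding g_def using holomorphic_fun_on_slice[OF F(1), of "ball 0 1" 0 v] mem that F(2)
        by (auto simp: image_subset_iff less_imp_le)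
      have "norm (z ^ n) < 1" using z n(1) by (simp add: norm_power power_less_one_iff)
      then have "norm (g (z ^ n) - g 0) \<le> norm (1 - cnj (g 0) * g (z ^ n)) * (norm (z ^ n) / 1)"
        using g by (intro schwarz_pick) auto
      moreover have "g (z ^ n) = b z" "g 0 = b 0"
        using Fb[OF z] fz by (simp_all add: g_def b0)
      ultimately show ?thesis by (simp add: norm_power)
    qed
    obtain \<psi> d where psi: "(\<psi> has_field_derivative d) (at 0)"
        "\<And>z. norm z < 1 \<Longrightarrow> disc_moebius (b 0) (b z) = z ^ n * \<psi> z"
        and lower: "1 - (norm (\<psi> 0))\<^sup>2 \<le> norm d"
      using blaschke_contact_order[OF zeta alpha k less[unfolded b_def] contact[unfolded b_def]]
      unfolding b_def by blast
    have "norm d \<le> 1 - a + a\<^sup>2 - (norm (\<psi> 0))\<^sup>2"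
      using psi(2) Fb
      by (intro slice_derivative_bound[OF assms(2,3) n(1) assms(5) F psi(1)])
         (simp add: f b0)
    \<comment> \<open>The terms in \<open>norm (\<psi> 0)\<close> cancel between the two bounds on
      \<open>norm d\<close>.\<close>
    then have "a * 1 \<le> a * a" using lower by (simp add: power2_eq_square)
    then show False using assms(2,3) by simp
  qed
qed

end
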